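(* Let $d\ge 1$ be an integer, let $p>0$, and let $\{\xi(\mathbf{n}),\ \mathbf{n}\in\mathbb{N}_0^d\}$ be a real-valued random field. Suppose that, for $s=1,\dots,d$, $\varphi_s:\mathbb{R}_+\to\mathbb{R}_+$ is an increasing function satisfying $C_3<\varphi_s(2x)/\varphi_s(x)<C_4$ for all $x\in\mathbb{R}_+$, for some constants $C_4\ge C_3>1$. Assume $a\ge 2$ is an integer that satisfies $C_3^{p\lfloor\log_2 a\rfloor}>\max\{a,\ a2^{p-1}\}$. If there is a function $g:\mathbb{N}_0^d\to[0,\infty)$ such that $$\mathbb{E}\big(|S(\mathbf{m};\mathbf{n})|^p\big)\le g(\mathbf{n})\qquad\text{for all }\mathbf{m},\mathbf{n}\in\mathbb{N}_0^d$$ and $$\sum_{\mathbf{n}\in\mathbb{N}_0^d}\frac{g(a^{n_1},\dots,a^{n_d})}{\varphi_1(a^{n_1})^p\cdots\varphi_d(a^{n_d})^p}<\infty,$$ then $$\lim_{|\mathbf{n}|\to\infty}\frac{\sum_{\mathbf{k}\in[\mathbf{1},\mathbf{n}]}\xi(\mathbf{k})}{\varphi_1(n_1)\cdots\varphi_d(n_d)}=0\quad\text{almost surely},$$ where $\mathbf{n}=(n_1,\dots,n_d)$ ranges over $\mathbb{N}^d$.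
   Context: $\mathbb{N}=\{1,2,\dots\}$, $\mathbb{N}_0=\mathbb{N}\cup\{0\}$, $\mathbb{R}_+=(0,\infty)$. For $\mathbf{n}=(n_1,\dots,n_d)\in\mathbb{N}_0^d$, $|\mathbf{n}|=\max\{n_1,\dots,n_d\}$. The partial order on $\mathbb{N}_0^d$ is coordinatewise, $[\mathbf{m},\mathbf{n}]=\{\mathbf{k}\in\mathbb{N}_0^d:\mathbf{m}\le\mathbf{k}\le\mathbf{n}\}$, and $\mathbf{1}=(1,\dots,1)$. For $\mathbf{m},\mathbf{n}\in\mathbb{N}_0^d$, $$S(\mathbf{m};\mathbf{n})=S(\mathbf{m};n_1,\dots,n_d)=\sum_{k_1=m_1+1}^{m_1+n_1}\cdots\sum_{k_d=m_d+1}^{m_d+n_d}\xi(k_1,\dots,k_d).$$ *)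

theory Defs
  imports "HOL-Probability.Probability"
begin

text \<open>
  Multi-indices in \<open>\<nat>\<^sub>0\<^sup>d\<close> are functions \<open>'d \<Rightarrow> nat\<close> on a finite type \<open>'d\<close> with \<open>d = CARD('d) \<ge> 1\<close>.
  The order on functions is pointwise, so \<open>{m..n}\<close> is the box \<open>[m, n]\<close>.
\<close>

definition max_norm :: "('d::finite \<Rightarrow> nat) \<Rightarrow> nat" where
  "max_norm n = Max (range n)"

definition field_sum ::
  "(('d::finite \<Rightarrow> nat) \<Rightarrow> 'a \<Rightarrow> real) \<Rightarrow> ('d \<Rightarrow> nat) \<Rightarrow> ('d \<Rightarrow> nat) \<Rightarrow> 'a \<Rightarrow> real" where
  "field_sum \<xi> m n \<omega> = (\<Sum>k\<in>{(\<lambda>i. m i + 1)..(\<lambda>i. m i + n i)}. \<xi> k \<omega>)"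

text \<open>The filter for \<open>|n| \<rightarrow> \<infinity>\<close> with \<open>n\<close> ranging over \<open>\<nat>\<^sup>d\<close>, where \<open>\<nat> = {1, 2, \<dots>}\<close>.\<close>

definition max_norm_at_top :: "('d::finite \<Rightarrow> nat) filter" where
  "max_norm_at_top = inf (filtercomap max_norm at_top) (principal {n. \<forall>i. 1 \<le> n i})"

lemma box_eq_PiE: "{m..n} = (\<Pi>\<^sub>E i\<in>UNIV. {m i..n i})" for m n :: "'d::finite \<Rightarrow> nat"
  by (auto simp: le_fun_def PiE_def Pi_def)

lemma finite_box: "finite {m..n}" for m n :: "'d::finite \<Rightarrow> nat"
  unfolding box_eq_PiE by (intro finite_PiE) auto

lemma eventually_max_norm_at_top:
  "eventually P max_norm_at_top \<longleftrightarrow> (\<exists>N. \<forall>n. (\<forall>i. 1 \<le> n i) \<and> N \<le> max_norm n \<longrightarrow> P n)"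
proof
  assume "eventually P max_norm_at_top"
  then obtain Q where Q: "eventually Q at_top" "\<And>n. Q (max_norm n) \<Longrightarrow> (\<forall>i. 1 \<le> n i) \<Longrightarrow> P n"
    by (auto simp: max_norm_at_top_def eventually_inf_principal eventually_filtercomap)
  then show "\<exists>N. \<forall>n. (\<forall>i. 1 \<le> n i) \<and> N \<le> max_norm n \<longrightarrow> P n"
    unfolding eventually_at_top_linorder by blast
next
  assume "\<exists>N. \<forall>n. (\<forall>i. 1 \<le> n i) \<and> N \<le> max_norm n \<longrightarrow> P n"
  then obtain N where "\<And>n. (\<forall>i. 1 \<le> n i) \<Longrightarrow> N \<le> max_norm n \<Longrightarrow> P n" by blast
  then show "eventually P max_norm_at_top"
    unfolding max_norm_at_top_def eventually_inf_principal eventually_filtercomap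
    by (intro exI[of _ "\<lambda>x. N \<le> x"]) (auto intro: eventually_ge_at_top)
qed

end

theory Submission imports Defs begin

text \<open>
  Split the box \<open>[1, k]\<close> along the base-\<open>a\<close> digits of the coordinates of \<open>k\<close> into blocks of side
  lengths \<open>a\<^sup>j\<close> with at most \<open>a\<^sup>d\<close> blocks for each \<open>j \<le> n\<close>, where \<open>a\<^sup>n \<le> k < a\<^sup>n\<^sup>+\<^sup>1\<close>.  For a
  suitable \<open>r < 1\<close>, the \<open>p\<close>-th moments of all block sums, divided by \<open>\<phi>(a\<^sup>n) r\<^sup>n\<^sup>-\<^sup>j\<close>, have a finite
  total, because \<open>\<phi>(a\<^sup>n)\<close> outgrows \<open>\<phi>(a\<^sup>j)\<close> faster than the \<open>p\<close>-th root of the number of blocks.  Hence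
  almost surely only finitely many normalised block sums exceed a given \<open>\<delta>\<close>, so for large \<open>|k|\<close> all
  blocks of \<open>[1, k]\<close> are small and their sum is at most a geometric series times \<open>\<delta> \<phi>(k)\<close>.  No
  maximal inequality is needed, and all \<open>p > 0\<close> are treated alike.
\<close>

section \<open>Base-\<open>a\<close> decomposition of a box into blocks\<close>

text \<open>Since \<open>y < k\<close>, the two inequalities say that \<open>y\<close> and
  \<open>k\<close> agree in all base-\<open>a\<close> digits above position \<open>j\<close> while
  the digit of \<open>y\<close> at \<open>j\<close> is the smaller one. So \<open>j\<close> is the
  position of the highest digit in which they differ.\<close>

lemma level_block_unique:
  fixes a k n y :: nat
  assumes "a \<ge> 2" and "k < a ^ (n + 1)" and "y < k"
  shows "\<exists>!j. j \<le> n \<and> a * (k div a ^ (j + 1)) \<le> y div a ^ j \<and> y div a ^ j < k div a ^ j"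
proof -
  \<comment> \<open>\<open>P\<close> is downward closed in \<open>j\<close>; the level sought is the last \<open>j\<close> with \<open>P j\<close>.\<close>
  define P where "P j \<longleftrightarrow> y div a ^ j < k div a ^ j" for j
  \<comment> \<open>The lower bound in the claim at level \<open>j\<close> is precisely the failure
    of \<open>P\<close> at level \<open>j + 1\<close>.\<close>
  have P_Suc: "y div a ^ Suc j < k div a ^ Suc j \<longleftrightarrow> \<not> a * (k div a ^ (j + 1)) \<le> y div a ^ j" for j
  proof -
    have "y div a ^ Suc j = (y div a ^ j) div a"
      by (metis div_mult2_eq power_Suc2)
    then show ?thesis
      using assms(1) less_eq_div_iff_mult_less_eq[of a "k div a ^ Suc j" "y div a ^ j"]
      by (simp add: mult.commute not_le[symmetric])
  qed
  have P_down: "P j" if "P (Suc j)" for j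
  proof (rule ccontr)
    assume "\<not> P j"
    then have "(k div a ^ j) div a \<le> (y div a ^ j) div a"
      by (simp add: P_def div_le_mono)
    with that show False
      by (simp add: P_def power_Suc2 div_mult2_eq del: power_Suc)
  qed
  have P_mono: "P i" if "P j" "i \<le> j" for i j
    using that(2,1) by (induction rule: inc_induct) (auto intro: P_down)
  have "P 0" using assms by (simp add: P_def)
  have top: "\<not> P (Suc n)" using assms by (simp add: P_def)
  define J where "J = (LEAST j. \<not> P (Suc j))"
  have J: "\<not> P (Suc J)" unfolding J_def using top by (rule LeastI)
  have J_le: "J \<le> n" unfolding J_def using top by (rule Least_le)
  have "P J"
  proof (cases J)
    case (Suc i)
    then show ?thesis using not_less_Least[of i "\<lambda>j. \<not> P (Suc j)"] by (auto simp: J_def)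
  qed (use \<open>P 0\<close> in simp)
  have eq: "i = J" if "P i" "\<not> P (Suc i)" for i
    using P_mono that J \<open>P J\<close> by (metis Suc_leI linorder_neqE_nat)
  show ?thesis
  proof (rule ex1I[of _ J])
    show "J \<le> n \<and> a * (k div a ^ (J + 1)) \<le> y div a ^ J \<and> y div a ^ J < k div a ^ J"
      using J J_le \<open>P J\<close> P_Suc[of J] by (simp add: P_def)
    show "i = J" if "i \<le> n \<and> a * (k div a ^ (i + 1)) \<le> y div a ^ i \<and> y div a ^ i < k div a ^ i" for i
      using that P_Suc[of i] by (intro eq) (auto simp: P_def)
  qed
qed

text \<open>Blocks start at \<open>b * c + 1\<close>, so the cell of a point is found by dividing
  \<open>x - 1\<close>. The case \<open>x = 0\<close> must be excluded, as truncated subtraction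
  would place it in cell 0.\<close>

lemma between_iff_div_eq:
  fixes x b c :: nat
  assumes "c > 0" and "x \<ge> 1"
  shows "b * c + 1 \<le> x \<and> x \<le> b * c + c \<longleftrightarrow> (x - 1) div c = b"
proof
  assume "b * c + 1 \<le> x \<and> x \<le> b * c + c"
  then show "(x - 1) div c = b"
    by (intro div_nat_eqI) (auto simp: mult.commute)
next
  assume "(x - 1) div c = b"
  then have "b * c \<le> x - 1 \<and> x - 1 < b * c + c"
    using assms by (metis add.commute dividend_less_div_times div_times_less_eq_dividend)
  then show "b * c + 1 \<le> x \<and> x \<le> b * c + c"
    using assms by linarith
qed

text \<open>
  The index \<open>b\<close> stands for the block \<open>\<Prod>\<^sub>i {b\<^sub>i a\<^sup>j + 1..b\<^sub>i a\<^sup>j + a\<^sup>j}\<close> with \<open>j = j\<^sub>i\<close>; in each coordinate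
  the blocks of level \<open>j\<close> fill the gap between \<open>k\<close> truncated to \<open>j + 1\<close> and to \<open>j\<close> low zero digits.
\<close>
definition level_box :: "nat \<Rightarrow> ('d::finite \<Rightarrow> nat) \<Rightarrow> ('d \<Rightarrow> nat) \<Rightarrow> ('d \<Rightarrow> nat) set" where
  "level_box a k j = (\<Pi>\<^sub>E i\<in>UNIV. {a * (k i div a ^ (j i + 1))..<k i div a ^ j i})"

lemma finite_level_box: "finite (level_box a k j)"
  unfolding level_box_def by (intro finite_PiE) auto

text \<open>In coordinate \<open>i\<close> the number of blocks of level \<open>j i\<close> is the
  base-\<open>a\<close> digit of \<open>k i\<close> at that position, hence below
  \<open>a\<close>.\<close>

lemma card_level_box_le:
  fixes k j :: "'d::finite \<Rightarrow> nat"
  assumes "a \<ge> 2"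
  shows "card (level_box a k j) \<le> a ^ CARD('d)"
proof -
  have "card {a * (k i div a ^ (j i + 1))..<k i div a ^ j i} \<le> a" for i
  proof -
    have "k i div a ^ (j i + 1) = (k i div a ^ j i) div a"
      by (simp add: power_Suc2 div_mult2_eq del: power_Suc)
    then have "k i div a ^ j i - a * (k i div a ^ (j i + 1)) = (k i div a ^ j i) mod a"
      by (simp add: minus_mult_div_eq_mod)
    then show ?thesis using assms by (simp add: less_imp_le)
  qed
  then have "card (level_box a k j) \<le> (\<Prod>i\<in>(UNIV :: 'd set). a)"
    unfolding level_box_def by (subst card_PiE) (simp, intro prod_mono, blast)
  then show ?thesis by simp
qed

text \<open>This confines the block indices to a range depending only on \<open>n - j\<close>, so
  that one finite family of blocks serves all \<open>k\<close> with the same leading levels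
  \<open>n\<close>.\<close>

lemma level_box_less:
  assumes "b \<in> level_box a k j" and "\<And>i. k i < a ^ (n i + 1)" and "\<And>i. j i \<le> n i"
  shows "b i < a ^ (n i - j i + 1)"
proof -
  have "a ^ (n i + 1) = a ^ (n i - j i + 1) * a ^ j i"
    using assms(3)[of i] by (simp flip: power_add)
  then have "k i div a ^ j i < a ^ (n i - j i + 1)"
    using assms(2)[of i] by (intro less_mult_imp_div_less) (simp only:)
  then show ?thesis
    using PiE_mem[OF assms(1)[unfolded level_box_def], of i] by simp
qed

text \<open>The blocks partition the box: applied to \<open>x i - 1\<close> in each coordinate,
  \<open>level_block_unique\<close> yields exactly one level vector for \<open>x\<close>, and the
  quotients by \<open>a ^ j i\<close> then fix the block index.\<close>

lemma sum_box_eq_sum_blocks: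
  fixes k n :: "'d::finite \<Rightarrow> nat"
  assumes "a \<ge> 2" and "\<And>i. k i < a ^ (n i + 1)"
  shows "(\<Sum>x\<in>{(\<lambda>_. 1)..k}. \<xi> x \<omega>) =
    (\<Sum>j\<in>(\<Pi>\<^sub>E i\<in>UNIV. {..n i}). \<Sum>b\<in>level_box a k j.
      field_sum \<xi> (\<lambda>i. b i * a ^ j i) (\<lambda>i. a ^ j i) \<omega>)"
proof -
  define I where "I = Sigma (\<Pi>\<^sub>E i\<in>UNIV. {..n i}) (level_box a k)"
  define B where "B = (\<lambda>(j, b). {(\<lambda>i. b i * a ^ j i + 1)..(\<lambda>i. b i * a ^ j i + a ^ j i)} :: ('d \<Rightarrow> nat) set)"
  have I_iff: "(j, b) \<in> I \<longleftrightarrow> (\<forall>i. j i \<le> n i \<and> a * (k i div a ^ (j i + 1)) \<le> b i \<and> b i < k i div a ^ j i)" for j b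
    by (auto simp: I_def PiE_iff level_box_def)
  have B_iff: "x \<in> B (j, b) \<longleftrightarrow> (\<forall>i. 1 \<le> x i \<and> (x i - 1) div a ^ j i = b i)" for x j b
  proof -
    have "x \<in> B (j, b) \<longleftrightarrow> (\<forall>i. b i * a ^ j i + 1 \<le> x i \<and> x i \<le> b i * a ^ j i + a ^ j i)"
      by (auto simp: B_def le_fun_def)
    also have "\<dots> \<longleftrightarrow> (\<forall>i. 1 \<le> x i \<and> (b i * a ^ j i + 1 \<le> x i \<and> x i \<le> b i * a ^ j i + a ^ j i))"
      by (meson le_add2 le_trans)
    also have "\<dots> \<longleftrightarrow> (\<forall>i. 1 \<le> x i \<and> (x i - 1) div a ^ j i = b i)"
      using assms(1) between_iff_div_eq by (metis not_numeral_le_zero zero_less_iff_neq_zero zero_less_power)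
    finally show ?thesis .
  qed
  have Un: "\<Union>(B ` I) = {(\<lambda>_. 1)..k}"
  proof (intro equalityI subsetI)
    fix x assume "x \<in> \<Union>(B ` I)"
    then obtain j b where jb: "(j, b) \<in> I" "x \<in> B (j, b)" by auto
    have "1 \<le> x i \<and> x i \<le> k i" for i
    proof -
      have "1 \<le> x i" "(x i - 1) div a ^ j i < k i div a ^ j i"
        using jb by (auto simp: I_iff B_iff)
      moreover from this(2) have "x i - 1 < k i" by (meson div_le_mono not_le)
      ultimately show ?thesis by linarith
    qed
    then show "x \<in> {(\<lambda>_. 1)..k}" by (auto simp: le_fun_def)
  next
    fix x assume "x \<in> {(\<lambda>_. 1)..k}"
    then have x: "1 \<le> x i" "x i \<le> k i" for i by (auto simp: le_fun_def)
    have less: "x i - 1 < k i" for i using x[of i] by linarith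
    have "\<exists>j. j \<le> n i \<and> a * (k i div a ^ (j + 1)) \<le> (x i - 1) div a ^ j
        \<and> (x i - 1) div a ^ j < k i div a ^ j" for i
      using level_block_unique[OF assms(1) assms(2) less] by (rule ex1_implies_ex)
    then obtain j where j: "\<And>i. j i \<le> n i \<and> a * (k i div a ^ (j i + 1)) \<le> (x i - 1) div a ^ j i
        \<and> (x i - 1) div a ^ j i < k i div a ^ j i"
      by metis
    have "(j, \<lambda>i. (x i - 1) div a ^ j i) \<in> I" using j by (simp add: I_iff)
    moreover have "x \<in> B (j, \<lambda>i. (x i - 1) div a ^ j i)" using x by (simp add: B_iff)
    ultimately show "x \<in> \<Union>(B ` I)" by blast
  qed
  have disj: "B u \<inter> B v = {}" if uv: "u \<in> I" "v \<in> I" "u \<noteq> v" for u v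
  proof (rule ccontr)
    assume "B u \<inter> B v \<noteq> {}"
    then obtain x where x: "x \<in> B u" "x \<in> B v" by blast
    obtain j b j' b' where eq: "u = (j, b)" "v = (j', b')" by (metis surj_pair)
    have xk: "x i - 1 < k i" for i
      using uv(1) x(1) unfolding eq I_iff B_iff by (metis div_le_mono not_le)
    have "j i = j' i" for i
      using level_block_unique[OF assms(1) assms(2) xk, of i] uv x unfolding eq I_iff B_iff by metis
    then have "j = j'" by blast
    moreover have "b = b'"
      using x unfolding eq B_iff \<open>j = j'\<close> by (metis ext)
    ultimately show False using uv(3) eq by simp
  qed
  have fin: "finite (\<Pi>\<^sub>E i\<in>UNIV. {..n i} :: ('d \<Rightarrow> nat) set)" by (intro finite_PiE) auto
  then have "finite I"
    unfolding I_def using finite_level_box by blast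
  then have "(\<Sum>x\<in>{(\<lambda>_. 1)..k}. \<xi> x \<omega>) = (\<Sum>u\<in>I. \<Sum>x\<in>B u. \<xi> x \<omega>)"
    unfolding Un[symmetric] using disj
    by (intro sum.UNION_disjoint) (auto simp: B_def intro: finite_box)
  also have "\<dots> = (\<Sum>(j, b)\<in>I. field_sum \<xi> (\<lambda>i. b i * a ^ j i) (\<lambda>i. a ^ j i) \<omega>)"
    by (intro sum.cong) (auto simp: field_sum_def B_def)
  also have "\<dots> = (\<Sum>j\<in>(\<Pi>\<^sub>E i\<in>UNIV. {..n i}). \<Sum>b\<in>level_box a k j.
      field_sum \<xi> (\<lambda>i. b i * a ^ j i) (\<lambda>i. a ^ j i) \<omega>)"
    unfolding I_def using fin finite_level_box by (subst sum.Sigma) auto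
  finally show ?thesis .
qed

section \<open>Geometric sums, almost sure finiteness and growth of the normalisers\<close>

text \<open>Enlarging \<open>F\<close> to a box makes the sum factor into one-dimensional geometric
  sums, which gives a bound independent of \<open>F\<close>.\<close>

lemma sum_prod_power_le:
  fixes q :: real and F :: "('d::finite \<Rightarrow> nat) set"
  assumes "0 \<le> q" "q < 1" "finite F"
  shows "(\<Sum>l\<in>F. \<Prod>i\<in>UNIV. q ^ l i) \<le> (1 / (1 - q)) ^ CARD('d)"
proof -
  \<comment> \<open>For empty \<open>F\<close> the value of this maximum is unspecified, but the
    inclusion below is then trivial.\<close>
  define N where "N i = Max ((\<lambda>l. l i) ` F)" for i
  have "F \<subseteq> (\<Pi>\<^sub>E i\<in>UNIV. {..N i})"
    using assms(3) by (auto simp: N_def)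
  then have "(\<Sum>l\<in>F. \<Prod>i\<in>UNIV. q ^ l i) \<le> (\<Sum>l\<in>(\<Pi>\<^sub>E i\<in>UNIV. {..N i}). \<Prod>i\<in>UNIV. q ^ l i)"
    using assms by (intro sum_mono2 prod_nonneg finite_PiE) auto
  also have "\<dots> = (\<Prod>i\<in>UNIV. \<Sum>l\<le>N i. q ^ l)"
    by (subst prod_sum_PiE) auto
  also have "\<dots> \<le> (\<Prod>i\<in>(UNIV :: 'd set). 1 / (1 - q))"
  proof (intro prod_mono conjI)
    fix i
    show "(\<Sum>l\<le>N i. q ^ l) \<le> 1 / (1 - q)"
      using sum_le_suminf[of "\<lambda>l. q ^ l" "{..N i}"] assms
      by (simp add: suminf_geometric summable_geometric)
  qed (use assms in \<open>auto intro: sum_nonneg\<close>)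
  finally show ?thesis by simp
qed

lemma summable_on_prod_power:
  fixes q :: real
  assumes "0 \<le> q" "q < 1"
  shows "(\<lambda>l :: 'd::finite \<Rightarrow> nat. \<Prod>i\<in>UNIV. q ^ l i) summable_on UNIV"
  using assms sum_prod_power_le[OF assms]
  by (intro nonneg_bdd_above_summable_on bdd_aboveI2[where M = "(1 / (1 - q)) ^ CARD('d)"] prod_nonneg) auto

text \<open>A Borel-Cantelli argument: by Tonelli the sum of the positive parts of the
  \<open>X i\<close> has finite integral, hence is finite almost everywhere. The exceptional null
  set does not depend on \<epsilon>, so the quantifier over \<epsilon> can stand inside.\<close>

lemma AE_finite_exceedances:
  fixes X :: "'i::countable \<Rightarrow> 'a \<Rightarrow> real"
  assumes meas: "\<And>i. X i \<in> borel_measurable M"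
    and bound: "\<And>i. (\<integral>\<^sup>+\<omega>. ennreal (X i \<omega>) \<partial>M) \<le> ennreal (c i)"
    and c: "\<And>i. c i \<ge> 0" "c summable_on UNIV"
  shows "AE \<omega> in M. \<forall>\<epsilon>>0. finite {i. \<epsilon> < X i \<omega>}"
proof -
  have [measurable]: "(\<lambda>\<omega>. ennreal (X i \<omega>)) \<in> borel_measurable M" for i
    using meas[of i] by measurable
  have pair_meas: "(\<lambda>(\<omega>, i). ennreal (X i \<omega>)) \<in> borel_measurable (M \<Otimes>\<^sub>M count_space UNIV)"
    unfolding split_beta
    by (rule measurable_compose_countable'[where f = "\<lambda>i u. ennreal (X i (fst u))" and g = snd and I = UNIV])
      auto
  have "(\<integral>\<^sup>+\<omega>. (\<integral>\<^sup>+i. ennreal (X i \<omega>) \<partial>count_space UNIV) \<partial>M)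
      = (\<integral>\<^sup>+i. (\<integral>\<^sup>+\<omega>. ennreal (X i \<omega>) \<partial>M) \<partial>count_space UNIV)"
    by (intro nn_integral_count_space_nn_integral) auto
  also have "\<dots> \<le> (\<integral>\<^sup>+i. ennreal (c i) \<partial>count_space UNIV)"
    by (intro nn_integral_mono bound)
  also have "\<dots> < \<infinity>"
  proof -
    have "integrable (count_space UNIV) c"
      using c abs_summable_equivalent[of c UNIV]
      unfolding Infinite_Set_Sum.abs_summable_on_def by simp
    then show ?thesis
      using c(1) by (simp add: nn_integral_eq_integral)
  qed
  finally have "AE \<omega> in M. (\<integral>\<^sup>+i. ennreal (X i \<omega>) \<partial>count_space UNIV) \<noteq> \<infinity>"
    by (intro nn_integral_PInf_AE sigma_finite_measure.borel_measurable_nn_integral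
      sigma_finite_measure_count_space_countable) (auto intro: pair_meas)
  then show ?thesis
  proof (eventually_elim, intro allI impI)
    fix \<omega> and \<epsilon> :: real
    assume fin: "(\<integral>\<^sup>+i. ennreal (X i \<omega>) \<partial>count_space UNIV) \<noteq> \<infinity>" and "\<epsilon> > 0"
    \<comment> \<open>Markov's inequality for the counting measure on the indices.\<close>
    have "ennreal \<epsilon> * emeasure (count_space UNIV) {i. \<epsilon> < X i \<omega>}
        = (\<integral>\<^sup>+i. ennreal \<epsilon> * indicator {i. \<epsilon> < X i \<omega>} i \<partial>count_space UNIV)"
      by (simp add: nn_integral_cmult_indicator)
    also have "\<dots> \<le> (\<integral>\<^sup>+i. ennreal (X i \<omega>) \<partial>count_space UNIV)"
      by (intro nn_integral_mono) (auto simp: indicator_def intro: ennreal_leI)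
    finally have "emeasure (count_space UNIV) {i. \<epsilon> < X i \<omega>} \<noteq> \<infinity>"
      using fin \<open>\<epsilon> > 0\<close> by (auto simp: ennreal_mult_eq_top_iff top_unique)
    then show "finite {i. \<epsilon> < X i \<omega>}"
      using emeasure_count_space_infinite by fastforce
  qed
qed

lemma field_sum_measurable:
  assumes "\<And>n. \<xi> n \<in> borel_measurable M"
  shows "field_sum \<xi> m n \<in> borel_measurable M"
  using assms unfolding field_sum_def[abs_def] by measurable

text \<open>As \<open>2 ^ L \<le> a\<close>, going from \<open>a ^ j\<close> to
  \<open>a ^ (j + l)\<close> contains \<open>L * l\<close> doublings, each worth a factor
  \<open>C\<close>; monotonicity covers the remaining distance.\<close>

lemma doubling_power_growth:
  fixes \<phi> :: "real \<Rightarrow> real" and C :: real and a L :: nat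
  assumes pos: "\<And>x. x > 0 \<Longrightarrow> \<phi> x > 0" and mono: "mono_on {0<..} \<phi>"
    and "C \<ge> 0" and double: "\<And>x. x > 0 \<Longrightarrow> C * \<phi> x \<le> \<phi> (2 * x)"
    and "2 ^ L \<le> a"
  shows "(C ^ L) ^ l * \<phi> (real (a ^ j)) \<le> \<phi> (real (a ^ (j + l)))"
proof -
  have iterate: "C ^ m * \<phi> x \<le> \<phi> (2 ^ m * x)" if "x > 0" for m x
  proof (induction m)
    case (Suc m)
    have "C * (C ^ m * \<phi> x) \<le> C * \<phi> (2 ^ m * x)"
      using Suc \<open>C \<ge> 0\<close> by (intro mult_left_mono) auto
    also have "\<dots> \<le> \<phi> (2 * (2 ^ m * x))"
      using that by (intro double) auto
    finally show ?case by (simp add: mult.assoc)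
  qed simp
  have "a > 0" using \<open>2 ^ L \<le> a\<close> by (cases a) auto
  have "(C ^ L) ^ l * \<phi> (real (a ^ j)) \<le> \<phi> (2 ^ (L * l) * real (a ^ j))"
    using iterate[of "real (a ^ j)" "L * l"] \<open>a > 0\<close> by (simp add: power_mult)
  also have "\<dots> \<le> \<phi> (real (a ^ (j + l)))"
  proof (rule mono_onD[OF mono])
    have "2 ^ (L * l) * a ^ j \<le> a ^ l * a ^ j"
      unfolding power_mult using \<open>2 ^ L \<le> a\<close> by (intro mult_right_mono power_mono) auto
    then have "real (2 ^ (L * l) * a ^ j) \<le> real (a ^ (j + l))"
      by (subst of_nat_le_iff) (simp add: power_add mult.commute)
    then show "2 ^ (L * l) * real (a ^ j) \<le> real (a ^ (j + l))" by simp
  qed (use \<open>a > 0\<close> in auto)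
  finally show ?thesis .
qed

section \<open>Convergence for a fixed sample point\<close>

text \<open>Here \<open>j\<close> is the level of a block and \<open>l\<close> its distance to the
  leading level \<open>n = j + l\<close> of the corner \<open>k\<close>. Finitely many exceptional
  pairs \<open>(j, l)\<close> rule out only finitely many \<open>n\<close>, so for large
  \<open>k\<close> every block obeys the threshold, and the factors \<open>r ^ l i\<close> make the
  thresholds summable.\<close>

lemma sum_box_tendsto_0:
  fixes \<phi> :: "'d::finite \<Rightarrow> real \<Rightarrow> real" and r :: real
  assumes "a \<ge> 2" and r: "0 < r" "r < 1"
    and pos: "\<And>s x. x > 0 \<Longrightarrow> \<phi> s x > 0" and mono: "\<And>s. mono_on {0<..} (\<phi> s)"
    and fin: "\<And>\<delta>. \<delta> > 0 \<Longrightarrow> finite {(j, l). \<exists>b. (\<forall>i. b i < a ^ (l i + 1)) \<and>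
      \<delta> * (\<Prod>i\<in>UNIV. \<phi> i (real (a ^ (j i + l i))) * r ^ l i) <
      \<bar>field_sum \<xi> (\<lambda>i. b i * a ^ j i) (\<lambda>i. a ^ j i) \<omega>\<bar>}"
  shows "((\<lambda>k. (\<Sum>x\<in>{(\<lambda>_. 1)..k}. \<xi> x \<omega>) / (\<Prod>i\<in>UNIV. \<phi> i (real (k i)))) \<longlongrightarrow> 0) max_norm_at_top"
proof (rule tendstoI)
  fix e :: real assume "e > 0"
  \<comment> \<open>\<open>K\<close> is the bound on the number of blocks per level vector times the
    bound on the sum of the weights; \<delta> is chosen so that the total becomes
    \<open>e / 2\<close>.\<close>
  define K where "K = real a ^ CARD('d) * (1 / (1 - r)) ^ CARD('d)"
  define \<delta> where "\<delta> = e / (2 * K)"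
  have "K > 0" using assms by (simp add: K_def)
  then have "\<delta> > 0" using \<open>e > 0\<close> by (simp add: \<delta>_def)
  define bad where "bad = {(j, l). \<exists>b. (\<forall>i. b i < a ^ (l i + 1)) \<and>
      \<delta> * (\<Prod>i\<in>UNIV. \<phi> i (real (a ^ (j i + l i))) * r ^ l i) <
      \<bar>field_sum \<xi> (\<lambda>i. b i * a ^ j i) (\<lambda>i. a ^ j i) \<omega>\<bar>}"
  define B where "B = (\<lambda>(j, l) i. j i + l i) ` bad"
  have "finite B" using fin[OF \<open>\<delta> > 0\<close>] by (simp add: B_def bad_def)
  \<comment> \<open>If the leading level of \<open>k\<close> lies in \<open>B\<close>, every
    coordinate of \<open>k\<close> is below \<open>N\<close>; hence
    \<open>N \<le> max_norm k\<close> keeps it out of \<open>B\<close>.\<close>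
  define N where "N = (\<Sum>n\<in>B. \<Sum>i\<in>UNIV. a ^ (n i + 1))"
  have "dist ((\<Sum>x\<in>{(\<lambda>_. 1)..k}. \<xi> x \<omega>) / (\<Prod>i\<in>UNIV. \<phi> i (real (k i)))) 0 < e"
    if k: "\<And>i. 1 \<le> k i" "N \<le> max_norm k" for k
  proof -
    have "\<exists>n. a ^ n \<le> k i \<and> k i < a ^ (n + 1)" for i
      by (rule ex_power_ivl1[OF \<open>a \<ge> 2\<close> k(1)])
    then obtain n where n: "\<And>i. a ^ n i \<le> k i" "\<And>i. k i < a ^ (n i + 1)" by metis
    have "n \<notin> B"
    proof
      assume "n \<in> B"
      obtain i where i: "max_norm k = k i"
        unfolding max_norm_def by (metis Max_in UNIV_not_empty finite finite_imageI image_iff image_is_empty)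
      have "k i < a ^ (n i + 1)" by (rule n)
      also have "\<dots> \<le> (\<Sum>i\<in>UNIV. a ^ (n i + 1))" by (rule member_le_sum) auto
      also have "\<dots> \<le> N"
        unfolding N_def using \<open>n \<in> B\<close> \<open>finite B\<close>
        by (intro member_le_sum[where f = "\<lambda>n. \<Sum>i\<in>UNIV. a ^ (n i + 1)"]) auto
      finally show False using k(2) i by simp
    qed
    define \<Phi> where "\<Phi> = (\<Prod>i\<in>UNIV. \<phi> i (real (a ^ n i)))"
    have "\<Phi> > 0" unfolding \<Phi>_def using pos \<open>a \<ge> 2\<close> by (intro prod_pos) auto
    have small: "\<bar>field_sum \<xi> (\<lambda>i. b i * a ^ j i) (\<lambda>i. a ^ j i) \<omega>\<bar> \<le> \<delta> * \<Phi> * (\<Prod>i\<in>UNIV. r ^ (n i - j i))"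
      if "j \<in> (\<Pi>\<^sub>E i\<in>UNIV. {..n i})" "b \<in> level_box a k j" for j b
    proof -
      have j: "j i \<le> n i" for i using that(1) by auto
      have "(j, \<lambda>i. n i - j i) \<notin> bad"
      proof
        assume "(j, \<lambda>i. n i - j i) \<in> bad"
        then have "(\<lambda>i. j i + (n i - j i)) \<in> B"
          unfolding B_def by (rule rev_image_eqI) simp
        then show False using \<open>n \<notin> B\<close> j by simp
      qed
      then have "\<not> \<delta> * (\<Prod>i\<in>UNIV. \<phi> i (real (a ^ (j i + (n i - j i)))) * r ^ (n i - j i))
          < \<bar>field_sum \<xi> (\<lambda>i. b i * a ^ j i) (\<lambda>i. a ^ j i) \<omega>\<bar>"
        using level_box_less[OF that(2) n(2) j] unfolding bad_def mem_Collect_eq case_prod_conv by blast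
      moreover have "(\<Prod>i\<in>UNIV. \<phi> i (real (a ^ (j i + (n i - j i)))) * r ^ (n i - j i))
          = \<Phi> * (\<Prod>i\<in>UNIV. r ^ (n i - j i))"
        unfolding \<Phi>_def prod.distrib[symmetric] using j by simp
      ultimately show ?thesis
        by (simp only: mult.assoc not_less)
    qed
    have "\<bar>\<Sum>x\<in>{(\<lambda>_. 1)..k}. \<xi> x \<omega>\<bar> \<le> (\<Sum>j\<in>(\<Pi>\<^sub>E i\<in>UNIV. {..n i}). \<Sum>b\<in>level_box a k j.
        \<bar>field_sum \<xi> (\<lambda>i. b i * a ^ j i) (\<lambda>i. a ^ j i) \<omega>\<bar>)"
      by (subst sum_box_eq_sum_blocks[OF \<open>a \<ge> 2\<close> n(2), of \<xi> \<omega>])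
        (intro order_trans[OF sum_abs] sum_mono order_refl)
    also have "\<dots> \<le> (\<Sum>j\<in>(\<Pi>\<^sub>E i\<in>UNIV. {..n i}). \<Sum>b\<in>level_box a k j. \<delta> * \<Phi> * (\<Prod>i\<in>UNIV. r ^ (n i - j i)))"
      by (intro sum_mono small)
    also have "\<dots> \<le> (\<Sum>j\<in>(\<Pi>\<^sub>E i\<in>UNIV. {..n i}). real a ^ CARD('d) * (\<delta> * \<Phi> * (\<Prod>i\<in>UNIV. r ^ (n i - j i))))"
    proof (intro sum_mono)
      fix j
      have "real (card (level_box a k j)) \<le> real a ^ CARD('d)"
        using card_level_box_le[OF \<open>a \<ge> 2\<close>, of k j] by (metis of_nat_le_iff of_nat_power)
      then show "(\<Sum>b\<in>level_box a k j. \<delta> * \<Phi> * (\<Prod>i\<in>UNIV. r ^ (n i - j i)))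
          \<le> real a ^ CARD('d) * (\<delta> * \<Phi> * (\<Prod>i\<in>UNIV. r ^ (n i - j i)))"
        using \<open>\<delta> > 0\<close> \<open>\<Phi> > 0\<close> r by (simp add: mult_right_mono prod_nonneg)
    qed
    also have "\<dots> = real a ^ CARD('d) * \<delta> * \<Phi> * (\<Sum>j\<in>(\<Pi>\<^sub>E i\<in>UNIV. {..n i}). \<Prod>i\<in>UNIV. r ^ (n i - j i))"
      by (simp add: sum_distrib_left mult_ac)
    also have "\<dots> \<le> real a ^ CARD('d) * \<delta> * \<Phi> * (1 / (1 - r)) ^ CARD('d)"
    proof (intro mult_left_mono)
      \<comment> \<open>Reindexing by the distance \<open>l = n - j\<close> loses nothing, because
        \<open>j \<le> n\<close> keeps the subtraction from truncating.\<close>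
      have "inj_on (\<lambda>j i. n i - j i) (\<Pi>\<^sub>E i\<in>UNIV. {..n i})"
      proof (intro inj_onI ext)
        fix j j' i
        assume "j \<in> (\<Pi>\<^sub>E i\<in>UNIV. {..n i})" "j' \<in> (\<Pi>\<^sub>E i\<in>UNIV. {..n i})"
          and eq: "(\<lambda>i. n i - j i) = (\<lambda>i. n i - j' i)"
        then have "j i \<le> n i" "j' i \<le> n i" by auto
        then show "j i = j' i" using fun_cong[OF eq, of i] by simp
      qed
      then have "(\<Sum>j\<in>(\<Pi>\<^sub>E i\<in>UNIV. {..n i}). \<Prod>i\<in>UNIV. r ^ (n i - j i))
          = (\<Sum>l\<in>(\<lambda>j i. n i - j i) ` (\<Pi>\<^sub>E i\<in>UNIV. {..n i}). \<Prod>i\<in>UNIV. r ^ l i)"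
        by (simp add: sum.reindex)
      also have "\<dots> \<le> (1 / (1 - r)) ^ CARD('d)"
        using r by (intro sum_prod_power_le finite_imageI finite_PiE) auto
      finally show "(\<Sum>j\<in>(\<Pi>\<^sub>E i\<in>UNIV. {..n i}). \<Prod>i\<in>UNIV. r ^ (n i - j i)) \<le> (1 / (1 - r)) ^ CARD('d)" .
    qed (use \<open>\<delta> > 0\<close> \<open>\<Phi> > 0\<close> in auto)
    also have "\<dots> = e / 2 * \<Phi>"
    proof -
      have "real a ^ CARD('d) * \<delta> * \<Phi> * (1 / (1 - r)) ^ CARD('d) = K * \<delta> * \<Phi>"
        by (simp add: K_def)
      then show ?thesis using \<open>K > 0\<close> by (simp add: \<delta>_def)
    qed
    also have "\<dots> \<le> e / 2 * (\<Prod>i\<in>UNIV. \<phi> i (real (k i)))"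
    proof -
      have "\<phi> i (real (a ^ n i)) \<le> \<phi> i (real (k i))" for i
        using n(1)[of i] \<open>a \<ge> 2\<close> k(1)[of i] by (intro mono_onD[OF mono[of i]]) (auto simp flip: of_nat_power)
      then have "\<Phi> \<le> (\<Prod>i\<in>UNIV. \<phi> i (real (k i)))"
        unfolding \<Phi>_def using pos \<open>a \<ge> 2\<close> by (intro prod_mono conjI less_imp_le[OF pos]) auto
      then show ?thesis using \<open>e > 0\<close> by (intro mult_left_mono) auto
    qed
    finally have le: "\<bar>\<Sum>x\<in>{(\<lambda>_. 1)..k}. \<xi> x \<omega>\<bar> \<le> e / 2 * (\<Prod>i\<in>UNIV. \<phi> i (real (k i)))" .
    have P: "(\<Prod>i\<in>UNIV. \<phi> i (real (k i))) > 0"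
      using k(1) by (intro prod_pos pos) (auto simp: Suc_le_eq)
    then have "e / 2 * (\<Prod>i\<in>UNIV. \<phi> i (real (k i))) < e * (\<Prod>i\<in>UNIV. \<phi> i (real (k i)))"
      using \<open>e > 0\<close> by simp
    then show ?thesis using le P by (simp add: dist_real_def abs_divide pos_divide_less_eq)
  qed
  then show "\<forall>\<^sub>F k in max_norm_at_top.
      dist ((\<Sum>x\<in>{(\<lambda>_. 1)..k}. \<xi> x \<omega>) / (\<Prod>i\<in>UNIV. \<phi> i (real (k i)))) 0 < e"
    unfolding eventually_max_norm_at_top by blast
qed

section \<open>Moment estimate for the blocks and the almost sure limit\<close>

theorem corollary1p3:
  fixes M :: "'a measure"
    and \<xi> :: "('d::finite \<Rightarrow> nat) \<Rightarrow> 'a \<Rightarrow> real"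
    and \<phi> :: "'d \<Rightarrow> real \<Rightarrow> real"
    and g :: "('d \<Rightarrow> nat) \<Rightarrow> real"
    and p C\<^sub>3 C\<^sub>4 :: real
    and a :: nat
  assumes "prob_space M"
    and "\<And>n. \<xi> n \<in> borel_measurable M"
    and "p > 0"
    and "\<And>s x. x > 0 \<Longrightarrow> \<phi> s x > 0"
    and "\<And>s. mono_on {0<..} (\<phi> s)"
    and "C\<^sub>4 \<ge> C\<^sub>3" and "C\<^sub>3 > 1"
    and "\<And>s x. x > 0 \<Longrightarrow> C\<^sub>3 < \<phi> s (2 * x) / \<phi> s x \<and> \<phi> s (2 * x) / \<phi> s x < C\<^sub>4"
    and "a \<ge> 2"
    and "C\<^sub>3 powr (p * real_of_int \<lfloor>log 2 (real a)\<rfloor>) > max (real a) (real a * 2 powr (p - 1))"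
    and "\<And>n. g n \<ge> 0"
    and "\<And>m n. (\<integral>\<^sup>+ \<omega>. ennreal (\<bar>field_sum \<xi> m n \<omega>\<bar> powr p) \<partial>M) \<le> ennreal (g n)"
    and "(\<lambda>n. g (\<lambda>i. a ^ n i) / (\<Prod>i\<in>UNIV. \<phi> i (real (a ^ n i)) powr p)) summable_on UNIV"
  shows "AE \<omega> in M.
    ((\<lambda>n. (\<Sum>k\<in>{(\<lambda>_. 1)..n}. \<xi> k \<omega>) / (\<Prod>i\<in>UNIV. \<phi> i (real (n i)))) \<longlongrightarrow> 0) max_norm_at_top"
proof -
  define L where "L = nat \<lfloor>log 2 (real a)\<rfloor>"
  define A where "A = C\<^sub>3 ^ L"
  have a: "a \<ge> 2" by fact
  have L: "real L = real_of_int \<lfloor>log 2 (real a)\<rfloor>"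
    using a by (simp add: L_def)
  have "2 powr real L \<le> 2 powr log 2 (real a)"
    unfolding L by (intro powr_mono of_int_floor_le) auto
  then have "real (2 ^ L) \<le> real a"
    using a by (simp add: powr_realpow)
  then have two_L: "2 ^ L \<le> a" by (simp only: of_nat_le_iff)
  have "A > 0" using assms(7) by (simp add: A_def)
  have "A powr p = C\<^sub>3 powr (p * real L)"
    using assms(7) by (simp add: A_def powr_powr mult.commute flip: powr_realpow)
  then have "real a < A powr p" using assms(10) L by simp
  then have "real a powr (1 / p) < (A powr p) powr (1 / p)"
    using \<open>p > 0\<close> a by (intro powr_less_mono2) auto
  then have "real a powr (1 / p) < A"
    using \<open>p > 0\<close> \<open>A > 0\<close> by (simp add: powr_powr)
  \<comment> \<open>\<open>A\<close> is the growth factor of \<open>\<phi>\<close> per level; splitting it as \<open>A = u / r\<close> leaves \<open>u\<close> to beat the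
    factor \<open>a\<close> in the number of blocks and \<open>r < 1\<close> to make the block sums geometric.\<close>
  then obtain u where u: "real a powr (1 / p) < u" "u < A" using dense by blast
  then have "u > 0" by (meson le_less_trans powr_ge_zero)
  have "(real a powr (1 / p)) powr p < u powr p"
    using u \<open>p > 0\<close> by (intro powr_less_mono2) auto
  then have u_p: "real a < u powr p"
    using \<open>p > 0\<close> a by (simp add: powr_powr)
  define r where "r = u / A"
  have r: "0 < r" "r < 1" using u \<open>u > 0\<close> \<open>A > 0\<close> by (simp_all add: r_def)
  \<comment> \<open>Per unit of \<open>l i\<close>, the range of block indices grows by the factor
    \<open>a\<close> and the \<open>p\<close>-th power of the threshold gains at least
    \<open>u powr p\<close>; \<open>q\<close> is the resulting contraction.\<close>
  define q where "q = real a / u powr p"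
  have q: "0 \<le> q" "q < 1" using u_p \<open>u > 0\<close> by (simp_all add: q_def)

  define G where "G j = g (\<lambda>i. a ^ j i) / (\<Prod>i\<in>UNIV. \<phi> i (real (a ^ j i)) powr p)" for j
  define D where "D j l = (\<Prod>i\<in>UNIV. \<phi> i (real (a ^ (j i + l i))) * r ^ l i)" for j l :: "'d \<Rightarrow> nat"
  \<comment> \<open>\<open>Bl l\<close> contains every block index that can occur at distance
    \<open>l\<close>, whatever \<open>k\<close> is. The \<open>+ 1\<close> in its exponent produces
    the factor \<open>a ^ CARD('d)\<close> in \<open>c\<close>.\<close>
  define Bl where "Bl l = (\<Pi>\<^sub>E i\<in>UNIV. {..<a ^ (l i + 1)})" for l :: "'d \<Rightarrow> nat"
  define X where "X = (\<lambda>(j, l) \<omega>. \<Sum>b\<in>Bl l. (\<bar>field_sum \<xi> (\<lambda>i. b i * a ^ j i) (\<lambda>i. a ^ j i) \<omega>\<bar> / D j l) powr p)"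
  define c where "c = (\<lambda>(j, l). real a ^ CARD('d) * G j * (\<Prod>i\<in>(UNIV :: 'd set). q ^ l i))"
  have D_pos: "D j l > 0" for j l
    unfolding D_def using r a by (intro prod_pos mult_pos_pos assms(4)) auto
  have G_nonneg: "G j \<ge> 0" for j
    unfolding G_def by (intro divide_nonneg_nonneg assms(11) prod_nonneg) auto
  have fin_Bl: "finite (Bl l)" for l unfolding Bl_def by (intro finite_PiE) auto
  have [measurable]: "field_sum \<xi> m n \<in> borel_measurable M" for m n
    by (rule field_sum_measurable[OF assms(2)])
  have X_meas: "X v \<in> borel_measurable M" for v
    unfolding X_def split_beta by measurable

  have weight: "real (card (Bl l)) * (g (\<lambda>i. a ^ j i) / D j l powr p) \<le> c (j, l)" for j l
  proof -
    have "(\<Prod>i\<in>UNIV. \<phi> i (real (a ^ j i)) powr p * (u powr p) ^ l i) \<le> D j l powr p"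
    proof -
      have "D j l powr p = (\<Prod>i\<in>UNIV. (\<phi> i (real (a ^ (j i + l i))) * r ^ l i) powr p)"
        unfolding D_def by (rule prod_powr_distrib)
      moreover have "(\<Prod>i\<in>UNIV. \<phi> i (real (a ^ j i)) powr p * (u powr p) ^ l i) \<le> (\<Prod>i\<in>UNIV. (\<phi> i (real (a ^ (j i + l i))) * r ^ l i) powr p)"
      proof (intro prod_mono conjI)
        fix i
        \<comment> \<open>Since \<open>u = r * A\<close>, part of the growth of \<phi> pays for the
          factor \<open>r ^ l i\<close> in the threshold and \<open>u ^ l i\<close> is left
          over.\<close>
        have "u ^ l i * \<phi> i (real (a ^ j i)) = r ^ l i * (A ^ l i * \<phi> i (real (a ^ j i)))"
          using \<open>A > 0\<close> by (simp add: r_def power_divide)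
        also have "\<dots> \<le> r ^ l i * \<phi> i (real (a ^ (j i + l i)))"
          unfolding A_def
        proof (intro mult_left_mono doubling_power_growth)
          show "C\<^sub>3 * \<phi> i x \<le> \<phi> i (2 * x)" if "x > 0" for x
            using assms(8)[OF that, of i] assms(4)[OF that, of i] by (simp add: pos_less_divide_eq)
        qed (use assms two_L r in auto)
        finally have "(u ^ l i * \<phi> i (real (a ^ j i))) powr p
            \<le> (\<phi> i (real (a ^ (j i + l i))) * r ^ l i) powr p"
          using \<open>u > 0\<close> \<open>p > 0\<close> assms(4)[of "real (a ^ j i)" i] a
          by (intro powr_mono2) (auto simp: mult.commute)
        moreover have "(u ^ l i * \<phi> i (real (a ^ j i))) powr p
            = \<phi> i (real (a ^ j i)) powr p * (u powr p) ^ l i"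
          using \<open>u > 0\<close> by (simp add: powr_mult powr_powr mult.commute flip: powr_realpow)
        ultimately show "\<phi> i (real (a ^ j i)) powr p * (u powr p) ^ l i
            \<le> (\<phi> i (real (a ^ (j i + l i))) * r ^ l i) powr p" by simp
      qed (use \<open>u > 0\<close> in auto)
      ultimately show ?thesis by simp
    qed
    then have D_ge: "(\<Prod>i\<in>UNIV. \<phi> i (real (a ^ j i)) powr p) * (\<Prod>i\<in>UNIV. (u powr p) ^ l i) \<le> D j l powr p"
      by (simp add: prod.distrib)
    have card: "real (card (Bl l)) = real a ^ CARD('d) * (\<Prod>i\<in>UNIV. real a ^ l i)"
      unfolding Bl_def by (subst card_PiE) (auto simp: prod.distrib)
    have "0 < (\<Prod>i\<in>UNIV. \<phi> i (real (a ^ j i)) powr p) * (\<Prod>i\<in>UNIV. (u powr p) ^ l i)"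
      using \<open>u > 0\<close> a assms(4) by (intro mult_pos_pos prod_pos) (auto simp: order.strict_implies_not_eq[symmetric])
    then have "real (card (Bl l)) * (g (\<lambda>i. a ^ j i) / D j l powr p) \<le> real (card (Bl l)) * (g (\<lambda>i. a ^ j i) /
        ((\<Prod>i\<in>UNIV. \<phi> i (real (a ^ j i)) powr p) * (\<Prod>i\<in>UNIV. (u powr p) ^ l i)))"
      using D_ge assms(11) by (intro mult_left_mono frac_le) auto
    also have "\<dots> = real a ^ CARD('d) * G j * ((\<Prod>i\<in>UNIV. real a ^ l i) / (\<Prod>i\<in>UNIV. (u powr p) ^ l i))"
      unfolding card G_def by simp
    also have "\<dots> = c (j, l)"
      unfolding c_def q_def by (simp add: power_divide prod_dividef)
    finally show ?thesis .
  qed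

  have X_bound: "(\<integral>\<^sup>+\<omega>. ennreal (X v \<omega>) \<partial>M) \<le> ennreal (c v)" for v
  proof -
    obtain j l where v: "v = (j, l)" by (cases v)
    \<comment> \<open>The moment hypothesis is uniform in the corner \<open>m\<close>, so all blocks
      of the same side lengths share one bound.\<close>
    have block: "(\<integral>\<^sup>+\<omega>. ennreal ((\<bar>field_sum \<xi> m n \<omega>\<bar> / D j l) powr p) \<partial>M) \<le> ennreal (g n / D j l powr p)" for m n
    proof -
      have "(\<integral>\<^sup>+\<omega>. ennreal ((\<bar>field_sum \<xi> m n \<omega>\<bar> / D j l) powr p) \<partial>M)
          = (\<integral>\<^sup>+\<omega>. ennreal (1 / D j l powr p) * ennreal (\<bar>field_sum \<xi> m n \<omega>\<bar> powr p) \<partial>M)"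
        using D_pos[of j l] by (intro nn_integral_cong) (simp add: powr_divide flip: ennreal_mult)
      also have "\<dots> = ennreal (1 / D j l powr p) * (\<integral>\<^sup>+\<omega>. ennreal (\<bar>field_sum \<xi> m n \<omega>\<bar> powr p) \<partial>M)"
        by (intro nn_integral_cmult) measurable
      also have "\<dots> \<le> ennreal (1 / D j l powr p) * ennreal (g n)"
        by (intro mult_left_mono assms(12)) auto
      finally show ?thesis using assms(11) by (simp flip: ennreal_mult)
    qed
    have "(\<integral>\<^sup>+\<omega>. ennreal (X v \<omega>) \<partial>M) = (\<Sum>b\<in>Bl l. \<integral>\<^sup>+\<omega>.
        ennreal ((\<bar>field_sum \<xi> (\<lambda>i. b i * a ^ j i) (\<lambda>i. a ^ j i) \<omega>\<bar> / D j l) powr p) \<partial>M)"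
      unfolding X_def v case_prod_conv
      by (subst nn_integral_sum[symmetric]) (simp_all add: sum_ennreal)
    also have "\<dots> \<le> (\<Sum>b\<in>Bl l. ennreal (g (\<lambda>i. a ^ j i) / D j l powr p))"
      by (intro sum_mono block)
    also have "\<dots> = ennreal (real (card (Bl l)) * (g (\<lambda>i. a ^ j i) / D j l powr p))"
      using assms(11) by (simp add: ennreal_of_nat_eq_real_of_nat flip: ennreal_mult)
    also have "\<dots> \<le> ennreal (c v)"
      unfolding v by (intro ennreal_leI weight)
    finally show ?thesis .
  qed

  have c_summable: "c summable_on UNIV"
  proof -
    \<comment> \<open>The bound is a product of \<open>G j\<close>, summable by hypothesis, and a
      geometric term in \<open>l\<close>.\<close>
    have "c summable_on UNIV \<times> UNIV"
    proof (rule summable_on_SigmaI)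
      fix j :: "'d \<Rightarrow> nat"
      show "((\<lambda>l. c (j, l)) has_sum
          (real a ^ CARD('d) * G j * (\<Sum>\<^sub>\<infinity>l. \<Prod>i\<in>(UNIV :: 'd set). q ^ l i))) UNIV"
        unfolding c_def case_prod_conv
        by (intro has_sum_cmult_right has_sum_infsum summable_on_prod_power q)
    next
      show "(\<lambda>j. real a ^ CARD('d) * G j * (\<Sum>\<^sub>\<infinity>l. \<Prod>i\<in>(UNIV :: 'd set). q ^ l i)) summable_on UNIV"
        using assms(13) unfolding G_def[symmetric]
        by (intro summable_on_cmult_left summable_on_cmult_right)
    qed (use q G_nonneg in \<open>auto simp: c_def prod_nonneg\<close>)
    then show ?thesis by simp
  qed
  have "AE \<omega> in M. \<forall>\<epsilon>>0. finite {v. \<epsilon> < X v \<omega>}"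
    using X_meas X_bound _ c_summable
    by (rule AE_finite_exceedances) (use q G_nonneg in \<open>auto simp: c_def prod_nonneg split: prod.split\<close>)
  then show ?thesis
  proof eventually_elim
    case (elim \<omega>)
    show ?case
    proof (rule sum_box_tendsto_0[where a = a and r = r])
      fix \<delta> :: real assume "\<delta> > 0"
      \<comment> \<open>One block above its threshold already forces \<open>X (j, l)\<close> above
        \<open>\<delta> powr p\<close>, as \<open>X\<close> is a sum of nonnegative terms; so the
        exceptional pairs are among the finitely many exceedances.\<close>
      have "{(j, l). \<exists>b. (\<forall>i. b i < a ^ (l i + 1)) \<and> \<delta> * D j l <
          \<bar>field_sum \<xi> (\<lambda>i. b i * a ^ j i) (\<lambda>i. a ^ j i) \<omega>\<bar>} \<subseteq> {v. \<delta> powr p < X v \<omega>}"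
      proof (clarify)
        fix j l b
        assume b: "\<forall>i. b i < a ^ (l i + 1)"
          and less: "\<delta> * D j l < \<bar>field_sum \<xi> (\<lambda>i. b i * a ^ j i) (\<lambda>i. a ^ j i) \<omega>\<bar>"
        have "\<delta> powr p < (\<bar>field_sum \<xi> (\<lambda>i. b i * a ^ j i) (\<lambda>i. a ^ j i) \<omega>\<bar> / D j l) powr p"
          using less \<open>\<delta> > 0\<close> \<open>p > 0\<close> D_pos[of j l]
          by (intro powr_less_mono2) (auto simp: pos_less_divide_eq)
        also have "\<dots> \<le> X (j, l) \<omega>"
          unfolding X_def case_prod_conv using b fin_Bl
          by (intro member_le_sum[where f = "\<lambda>b. (\<bar>field_sum \<xi> (\<lambda>i. b i * a ^ j i) (\<lambda>i. a ^ j i) \<omega>\<bar> / D j l) powr p"])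
            (auto simp: Bl_def)
        finally show "\<delta> powr p < X (j, l) \<omega>" .
      qed
      moreover have "finite {v. \<delta> powr p < X v \<omega>}" using elim \<open>\<delta> > 0\<close> by simp
      ultimately show "finite {(j, l). \<exists>b. (\<forall>i. b i < a ^ (l i + 1)) \<and>
          \<delta> * (\<Prod>i\<in>UNIV. \<phi> i (real (a ^ (j i + l i))) * r ^ l i) <
          \<bar>field_sum \<xi> (\<lambda>i. b i * a ^ j i) (\<lambda>i. a ^ j i) \<omega>\<bar>}"
        unfolding D_def by (rule finite_subset)
    qed (use a r assms(4,5) in auto)
  qed
qed

end
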